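(* If $n>3$, there exist (nonempty) families of vital frames of size $2n$ in $\mathbb{R}^n$, no member of which is equivalent to a frame coming from an $(n,n-1,n-2)$ block design.
   Context: A frame in $\mathbb{R}^n$ is a finite (indexed) family of vectors spanning $\mathbb{R}^n$; its size is the number of its elements. A finite family $\{u_i\}_{i=1}^m\subset\mathbb{R}^n$ permits phase retrieval if for all $\psi,\phi\in\mathbb{R}^n$, $|\langle u_i,\psi\rangle|^2=|\langle u_i,\phi\rangle|^2$ for all $i$ implies $\phi=\pm\psi$. A frame is vital if it permits phase retrieval, but removing any single vector yields a family that does not permit phase retrieval. Two $m$-element frames $\mathcal{F}_1,\mathcal{F}_2$ in $\mathbb{R}^n$ are equivalent if there exist $A\in\mathrm{GL}_n(\mathbb{R})$ and a permutation $\sigma\in S_m$ such that applying $A$ to all vectors of $\mathcal{F}_1$ gives $\mathcal{F}_2$ reordered by $\sigma$. An $(n,k,\lambda)$-design is a pair $([n],\mathcal{B})$ with $[n]=\{1,\dots,n\}$ and $\mathcal{B}=\{B_1,\dots,B_b\}$ a finite indexed collection of $k$-element subsets (blocks) of $[n]$ such that every pair of distinct points lies in exactly $\lambda$ blocks. A frame comes from the design $\mathcal{B}$ if it has the form $\{e_1,\dots,e_n\}\cup\{v_1,\dots,v_b\}$, where $e_1,\dots,e_n$ is the standard basis of $\mathbb{R}^n$ and each $v_i\in\mathbb{R}^n$ has support contained in $B_i$. An $(n,n-1,n-2)$ design has $n$ blocks, namely $B_i=[n]\setminus\{i\}$, $i=1,\dots,n$ (up to reordering). *)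

theory Defs
  imports "HOL-Analysis.Analysis" "HOL-Combinatorics.Permutations"
begin

text \<open>
  Finite families of vectors are functions restricted to a finite index set \<open>I\<close>, so repeated
  vectors are allowed and values outside \<open>I\<close> are irrelevant. The space is \<open>real ^ 'n\<close>, so that
  \<open>n = CARD('n)\<close>, the point set \<open>[n]\<close> is \<open>UNIV :: 'n set\<close>, and \<open>e\<^sub>i\<close> is \<open>axis i 1\<close>.
\<close>

definition vector_frame :: "'i set \<Rightarrow> ('i \<Rightarrow> real ^ 'n) \<Rightarrow> bool" where
  "vector_frame I u \<longleftrightarrow> finite I \<and> span (u ` I) = UNIV"

definition permits_phase_retrieval :: "'i set \<Rightarrow> ('i \<Rightarrow> real ^ 'n) \<Rightarrow> bool" where
  "permits_phase_retrieval I u \<longleftrightarrow>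
     (\<forall>\<psi> \<phi>. (\<forall>i\<in>I. \<bar>u i \<bullet> \<psi>\<bar>\<^sup>2 = \<bar>u i \<bullet> \<phi>\<bar>\<^sup>2) \<longrightarrow> \<phi> = \<psi> \<or> \<phi> = - \<psi>)"

definition vital_frame :: "'i set \<Rightarrow> ('i \<Rightarrow> real ^ 'n) \<Rightarrow> bool" where
  "vital_frame I u \<longleftrightarrow>
     vector_frame I u \<and> permits_phase_retrieval I u \<and>
     (\<forall>j\<in>I. \<not> permits_phase_retrieval (I - {j}) u)"

definition equivalent_frames ::
  "nat \<Rightarrow> (nat \<Rightarrow> real ^ 'n) \<Rightarrow> (nat \<Rightarrow> real ^ 'n) \<Rightarrow> bool" where
  "equivalent_frames m u w \<longleftrightarrow>
     (\<exists>(A :: real ^ 'n ^ 'n) \<sigma>. invertible A \<and> \<sigma> permutes {1..m} \<and>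
        (\<forall>i\<in>{1..m}. A *v u i = w (\<sigma> i)))"

definition block_design ::
  "nat \<Rightarrow> nat \<Rightarrow> nat \<Rightarrow> nat \<Rightarrow> (nat \<Rightarrow> ('n::finite) set) \<Rightarrow> bool" where
  "block_design n k l b B \<longleftrightarrow>
     CARD('n) = n \<and>
     (\<forall>i\<in>{1..b}. card (B i) = k) \<and>
     (\<forall>x y. x \<noteq> y \<longrightarrow> card {i\<in>{1..b}. x \<in> B i \<and> y \<in> B i} = l)"

text \<open>
  The bijection \<open>h\<close> identifies \<open>I\<close> with the disjoint union of the index sets of the \<open>e\<^sub>i\<close> and the
  \<open>v\<^sub>i\<close>: the union of the two families is a union of indexed families, taken in no particular order.
\<close>

definition comes_from_design ::
  "'i set \<Rightarrow> ('i \<Rightarrow> real ^ 'n) \<Rightarrow> nat \<Rightarrow> (nat \<Rightarrow> 'n set) \<Rightarrow> bool" where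
  "comes_from_design I u b B \<longleftrightarrow>
     (\<exists>v h. bij_betw h ((UNIV :: 'n set) <+> {1..b}) I \<and>
        (\<forall>j. u (h (Inl j)) = axis j 1) \<and>
        (\<forall>i\<in>{1..b}. u (h (Inr i)) = v i \<and> {j. v i $ j \<noteq> 0} \<subseteq> B i))"

end

theory Submission
  imports Defs "HOL-Computational_Algebra.Polynomial"
begin

text \<open>
  Take vectors on the curve \<open>x \<mapsto> (1, x, \<dots>, x\<^bsup>n-2\<^esup>, x\<^bsup>n\<^esup>)\<close>. A hyperplane meets it in the roots of a
  polynomial of degree at most \<open>n\<close> without \<open>x\<^bsup>n-1\<^esup>\<close> term, so more than \<open>n\<close> points of the curve always
  span, and \<open>n\<close> points fail to span exactly when their parameters sum to zero. The family with
  parameters \<open>-(n-1), \<dots>, n-1\<close> and \<open>1/2\<close> is then vital: as the total \<open>1/2\<close> is nonzero, no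
  splitting in halves has two zero-sum parts, and every parameter is avoided by a zero-sum set of \<open>n\<close>
  parameters, whose complement minus that parameter has only \<open>n - 1\<close> elements.

  If the family were equivalent to a design frame, it would split into a basis \<open>p\<close> and vectors
  \<open>q\<close> such that replacing any single \<open>p k\<close> by \<open>q k\<close> leaves a set in a hyperplane. On parameters this
  says that \<open>p k - q k\<close> is the sum \<open>s\<close> of all \<open>p j\<close>, for every \<open>k\<close>; summing over \<open>k\<close> gives
  \<open>(2 - n) s = 1/2\<close>, so \<open>0 < \<bar>s\<bar> \<le> 1/4\<close>, but no parameter lies at that distance from \<open>0\<close>.
\<close>

section \<open>Phase retrieval in terms of hyperplanes\<close>

text \<open>The difference of the two squares factors into the inner products with
  \<open>\<phi> - \<psi>\<close> and \<open>\<phi> + \<psi>\<close>. The criterion is the complement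
  property: the family is not a union of two parts that each lie in a hyperplane.\<close>

lemma permits_phase_retrieval_iff:
  fixes u :: "'i \<Rightarrow> real ^ 'n"
  shows "permits_phase_retrieval I u \<longleftrightarrow>
    (\<forall>a b. (\<forall>i\<in>I. u i \<bullet> a = 0 \<or> u i \<bullet> b = 0) \<longrightarrow> a = 0 \<or> b = 0)" (is "_ \<longleftrightarrow> ?R")
proof
  assume L: "permits_phase_retrieval I u"
  show ?R
  proof (intro allI impI)
    fix a b assume ab: "\<forall>i\<in>I. u i \<bullet> a = 0 \<or> u i \<bullet> b = 0"
    have "\<bar>u i \<bullet> (a + b)\<bar>\<^sup>2 = \<bar>u i \<bullet> (a - b)\<bar>\<^sup>2" if "i \<in> I" for i
      using ab that by (auto simp: inner_add_right inner_diff_right)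
    then have "a - b = a + b \<or> a - b = - (a + b)"
      using L unfolding permits_phase_retrieval_def by blast
    then show "a = 0 \<or> b = 0"
    proof
      assume "a - b = a + b"
      then have "2 *\<^sub>R b = 0" by (simp add: scaleR_2 algebra_simps)
      then show ?thesis by simp
    next
      assume "a - b = - (a + b)"
      then have "2 *\<^sub>R a = 0" by (simp add: scaleR_2 algebra_simps)
      then show ?thesis by simp
    qed
  qed
next
  assume R: ?R
  show "permits_phase_retrieval I u"
    unfolding permits_phase_retrieval_def
  proof (intro allI impI)
    fix \<psi> \<phi> assume *: "\<forall>i\<in>I. \<bar>u i \<bullet> \<psi>\<bar>\<^sup>2 = \<bar>u i \<bullet> \<phi>\<bar>\<^sup>2"
    have "\<forall>i\<in>I. u i \<bullet> (\<phi> - \<psi>) = 0 \<or> u i \<bullet> (\<phi> + \<psi>) = 0"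
    proof
      fix i assume "i \<in> I"
      then have "(u i \<bullet> \<phi>)\<^sup>2 = (u i \<bullet> \<psi>)\<^sup>2" using * by simp
      then have "u i \<bullet> \<phi> = u i \<bullet> \<psi> \<or> u i \<bullet> \<phi> = - (u i \<bullet> \<psi>)"
        by (simp add: power2_eq_iff)
      then show "u i \<bullet> (\<phi> - \<psi>) = 0 \<or> u i \<bullet> (\<phi> + \<psi>) = 0"
        by (auto simp: inner_add_right inner_diff_right)
    qed
    then have "\<phi> - \<psi> = 0 \<or> \<phi> + \<psi> = 0" using R by blast
    then show "\<phi> = \<psi> \<or> \<phi> = - \<psi>" by (auto simp: eq_neg_iff_add_eq_0)
  qed
qed

text \<open>A nonzero vector orthogonal to the whole family could serve as both \<open>a\<close> and
  \<open>b\<close> in the criterion above.\<close>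

lemma vector_frame_if_permits_phase_retrieval:
  fixes u :: "'i \<Rightarrow> real ^ 'n"
  assumes "finite I" "permits_phase_retrieval I u"
  shows "vector_frame I u"
proof (rule ccontr)
  assume "\<not> vector_frame I u"
  then have "span (u ` I) \<noteq> UNIV" using assms(1) by (simp add: vector_frame_def)
  then obtain a where "a \<noteq> 0" and a: "\<forall>x\<in>span (u ` I). a \<bullet> x = 0"
    using span_not_UNIV_orthogonal by blast
  have "u i \<bullet> a = 0" if "i \<in> I" for i
    using a that by (metis image_eqI inner_commute span_base)
  then show False
    using assms(2) \<open>a \<noteq> 0\<close> unfolding permits_phase_retrieval_iff by blast
qed

lemma ex_orthogonal_if_card_less:
  fixes u :: "'i \<Rightarrow> real ^ 'n"
  assumes "finite S" "card S < CARD('n)"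
  shows "\<exists>a. a \<noteq> 0 \<and> (\<forall>i\<in>S. u i \<bullet> a = 0)"
proof -
  have "dim (u ` S) \<le> card S"
    using assms(1) by (metis card_image_le dim_le_card' finite_imageI le_trans)
  then have "dim (u ` S) < DIM(real ^ 'n)" using assms(2) by simp
  then have "span (u ` S) \<noteq> UNIV" by (metis dim_UNIV dim_span nless_le)
  then obtain a where "a \<noteq> 0" and a: "\<forall>x\<in>span (u ` S). a \<bullet> x = 0"
    using span_not_UNIV_orthogonal by blast
  then show ?thesis by (metis image_eqI inner_commute span_base)
qed

section \<open>Coefficients of products of linear factors\<close>

lemma degree_prod_linear:
  fixes t :: "'i \<Rightarrow> 'a::idom"
  assumes "finite S"
  shows "degree (\<Prod>i\<in>S. [:- t i, 1:]) = card S"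
  by (subst degree_prod_eq_sum_degree) auto

lemma lead_coeff_prod_linear:
  fixes t :: "'i \<Rightarrow> 'a::idom"
  assumes "finite S"
  shows "coeff (\<Prod>i\<in>S. [:- t i, 1:]) (card S) = 1"
  using lead_coeff_prod[of "\<lambda>i. [:- t i, 1:]" S] degree_prod_linear[OF assms, of t] by simp

text \<open>Vieta's formula for the second coefficient; it turns a missing power into a zero-sum
  condition on the roots.\<close>

lemma subleading_coeff_prod_linear:
  fixes t :: "'i \<Rightarrow> 'a::idom"
  assumes "finite S" "card S = Suc m"
  shows "coeff (\<Prod>i\<in>S. [:- t i, 1:]) m = - (\<Sum>i\<in>S. t i)"
  using assms
proof (induction S arbitrary: m rule: finite_induct)
  case (insert x F)
  then have F: "card F = m" by simp
  have lead: "coeff (\<Prod>i\<in>F. [:- t i, 1:]) m = 1"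
    using lead_coeff_prod_linear[OF insert.hyps(1), of t] F by simp
  \<comment> \<open>For \<open>m = 0\<close> the set \<open>F\<close> is empty; the induction
    hypothesis applies only when \<open>card F\<close> is a successor.\<close>
  show ?case
  proof (cases m)
    case 0
    then show ?thesis using insert F lead by simp
  next
    case (Suc k)
    then show ?thesis using insert F lead by simp
  qed
qed simp

section \<open>The moment curve with a gap in its exponents\<close>

lemma bij_exponents:
  assumes "2 \<le> n"
  shows "bij_betw (\<lambda>k. if k = n - 1 then n else k) {..<n} ({..n} - {n - 1 :: nat})"
  by (rule bij_betwI[where g = "\<lambda>k. if k = n then n - 1 else k"])
     (use assms in \<open>auto split: if_splits\<close>)

text \<open>The index type carries no order, so an injective map \<open>g\<close> decides which
  coordinate is the coefficient of which power. Normals of hyperplanes thereby become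
  polynomials.\<close>

definition gap_poly :: "('n::finite \<Rightarrow> nat) \<Rightarrow> real ^ 'n \<Rightarrow> real poly" where
  "gap_poly g a = (\<Sum>k\<in>UNIV. monom (a $ k) (g k))"

definition gap_curve :: "('n::finite \<Rightarrow> nat) \<Rightarrow> real \<Rightarrow> real ^ 'n" where
  "gap_curve g x = (\<chi> k. x ^ g k)"

lemma inner_gap_curve: "gap_curve g x \<bullet> a = poly (gap_poly g a) x"
  by (simp add: gap_curve_def gap_poly_def inner_vec_def poly_sum poly_monom mult.commute)

lemma coeff_gap_poly:
  assumes "inj g"
  shows "coeff (gap_poly g a) (g k) = a $ k"
proof -
  have "coeff (gap_poly g a) (g k) = (\<Sum>j\<in>UNIV. if j = k then a $ j else 0)"
    unfolding gap_poly_def coeff_sum using assms by (intro sum.cong) (auto dest: injD)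
  then show ?thesis by simp
qed

lemma coeff_gap_poly_eq_0:
  assumes "m \<notin> range g"
  shows "coeff (gap_poly g a) m = 0"
  unfolding gap_poly_def coeff_sum using assms by (intro sum.neutral) auto

lemma gap_poly_coeffs:
  assumes "inj g" "\<And>m. m \<notin> range g \<Longrightarrow> coeff p m = 0"
  shows "gap_poly g (\<chi> k. coeff p (g k)) = p"
proof (rule poly_eqI)
  fix m
  show "coeff (gap_poly g (\<chi> k. coeff p (g k))) m = coeff p m"
    using assms by (cases "m \<in> range g") (auto simp: coeff_gap_poly coeff_gap_poly_eq_0)
qed

text \<open>With at least \<open>n\<close> roots and degree at most \<open>n\<close>,
  \<open>p\<close> must be a scalar multiple of the product of the linear factors over
  \<open>S\<close>. By Vieta its coefficient at \<open>n - 1\<close> is, up to sign, the leading one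
  times the sum of the roots.\<close>

lemma zero_sum_if_poly_vanishes:
  fixes p :: "real poly"
  assumes "finite S" "inj_on t S" "card S \<ge> n" "n \<ge> 1"
    and "p \<noteq> 0" "degree p \<le> n" "coeff p (n - 1) = 0"
    and root: "\<And>i. i \<in> S \<Longrightarrow> poly p (t i) = 0"
  shows "card S = n \<and> (\<Sum>i\<in>S. t i) = 0"
proof -
  have few: "card S \<le> degree q" if "q \<noteq> 0" "\<And>i. i \<in> S \<Longrightarrow> poly q (t i) = 0" for q :: "real poly"
  proof -
    have "card S = card (t ` S)" using assms(2) by (simp add: card_image)
    also have "\<dots> \<le> card {x. poly q x = 0}"
      using that by (intro card_mono poly_roots_finite) auto
    also have "\<dots> \<le> degree q" using that(1) by (rule card_poly_roots_bound)
    finally show ?thesis .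
  qed
  have card: "card S = n" using few[OF \<open>p \<noteq> 0\<close> root] assms by linarith
  define P where "P = (\<Prod>i\<in>S. [:- t i, 1:])"
  \<comment> \<open>Cancelling the coefficient at \<open>n\<close> leaves degree below
    \<open>n\<close> but keeps the \<open>n\<close> roots, which forces
    \<open>q = 0\<close>.\<close>
  define q where "q = p - smult (coeff p n) P"
  have "coeff P n = 1"
    using lead_coeff_prod_linear[OF assms(1), of t] card by (simp add: P_def)
  then have "coeff q n = 0" by (simp add: q_def)
  moreover have "degree q \<le> n"
    unfolding q_def using assms(6) degree_prod_linear[OF assms(1), of t] card
    by (intro degree_diff_le) (auto simp: P_def intro: le_trans[OF degree_smult_le])
  \<comment> \<open>If the degree were \<open>n\<close>, the leading coefficient would vanish, so
    \<open>q = 0\<close>, whose degree is 0 by convention and thus below \<open>n\<close>.\<close>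
  ultimately have "degree q < n"
    using assms(4) by (metis degree_0 le_neq_implies_less leading_coeff_0_iff less_eq_Suc_le One_nat_def)
  moreover have "poly q (t i) = 0" if "i \<in> S" for i
    using root[OF that] that assms(1) by (auto simp: q_def P_def poly_prod)
  ultimately have "q = 0" using few[of q] card by fastforce
  then have p: "p = smult (coeff p n) P" by (simp add: q_def)
  then have "coeff p n \<noteq> 0" using \<open>p \<noteq> 0\<close> by auto
  moreover have "coeff P (n - 1) = - (\<Sum>i\<in>S. t i)"
    unfolding P_def by (rule subleading_coeff_prod_linear) (use assms(1,4) card in auto)
  ultimately show ?thesis using assms(7) card p by (metis coeff_smult mult_eq_0_iff neg_equal_0_iff_equal)
qed

section \<open>Zero-sum sets of integers\<close>

text \<open>Pairs \<open>x\<close>, \<open>-x\<close> settle even \<open>n\<close>. For odd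
  \<open>n\<close> the element 0 is added, or the triple 1, 2, -3 if 0 is the one to avoid.\<close>

lemma zero_sum_subset_avoiding:
  fixes j :: int
  assumes "n \<ge> 4"
  shows "\<exists>S. S \<subseteq> {1 - int n..int n - 1} - {j} \<and> card S = n \<and> \<Sum>S = 0"
proof -
  have symm: "\<exists>S. S \<subseteq> P \<union> uminus ` P \<and> finite S \<and> card S = 2 * k \<and> \<Sum>S = 0"
    if P: "finite P" "P \<subseteq> {1..}" "k \<le> card P" for P :: "int set" and k
  proof -
    obtain Q where Q: "Q \<subseteq> P" "card Q = k" "finite Q"
      using obtain_subset_with_card_n[OF P(3)] by metis
    have pos: "x \<ge> 1" if "x \<in> Q" for x using Q(1) P(2) that by auto
    have disj: "Q \<inter> uminus ` Q = {}" unfolding disjoint_iff by (auto dest!: pos)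
    have "card (Q \<union> uminus ` Q) = 2 * k"
      using disj Q by (simp add: card_Un_disjoint card_image)
    moreover have "\<Sum>(Q \<union> uminus ` Q) = 0"
      using disj Q by (simp add: sum.union_disjoint sum.reindex sum_negf)
    ultimately show ?thesis using Q by (intro exI[of _ "Q \<union> uminus ` Q"]) auto
  qed
  define k where "k = n div 2"
  \<comment> \<open>Elements are used with both signs, so leaving out the absolute value keeps
    \<open>j\<close> itself out. At least \<open>n - 2\<close> elements remain, enough for
    \<open>n div 2\<close> pairs as \<open>n\<close> is at least 4.\<close>
  define P where "P = {1..int n - 1} - {\<bar>j\<bar>}"
  have P: "finite P" "P \<subseteq> {1..}" by (auto simp: P_def)
  have "card P \<ge> n - 2"
    using diff_card_le_card_Diff[of "{\<bar>j\<bar>}" "{1..int n - 1}"] by (simp add: P_def)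
  then have "k \<le> card P" using assms by (simp add: k_def)
  then obtain S where S: "S \<subseteq> P \<union> uminus ` P" "finite S" "card S = 2 * k" "\<Sum>S = 0"
    using symm[of P k, OF P] by blast
  have SP: "S \<subseteq> {1 - int n..int n - 1} - {j, 0}"
    using S(1) by (auto simp: P_def)
  consider "even n" | "odd n" "j \<noteq> 0" | "odd n" "j = 0" by blast
  then show ?thesis
  proof cases
    case 1
    then show ?thesis using SP S by (intro exI[of _ S]) (auto simp: k_def)
  next
    case 2
    then have "n = Suc (2 * k)" by (simp add: k_def)
    moreover have "0 \<notin> S" using SP by auto
    ultimately show ?thesis using SP S 2 assms by (intro exI[of _ "insert 0 S"]) auto
  next
    case 3
    \<comment> \<open>Pairs from 4 on stay clear of the triple 1, 2, -3. Here \<open>n\<close> is at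
      least 5, so these \<open>n - 4\<close> numbers suffice for the \<open>k - 1\<close> pairs that
      are still missing.\<close>
    define P' where "P' = {4..int n - 1}"
    have P': "finite P'" "P' \<subseteq> {1..}" by (auto simp: P'_def)
    have n: "n = 2 * (k - 1) + 3" using 3 assms by (auto simp: k_def elim!: oddE)
    then have "k - 1 \<le> card P'" using 3 assms by (auto simp: P'_def)
    then obtain S' where S': "S' \<subseteq> P' \<union> uminus ` P'" "finite S'" "card S' = 2 * (k - 1)" "\<Sum>S' = 0"
      using symm[of P' "k - 1", OF P'] by blast
    have S'': "1 \<notin> S'" "2 \<notin> S'" "-3 \<notin> S'" "0 \<notin> S'" "S' \<subseteq> {1 - int n..int n - 1}"
      using S'(1) by (auto simp: P'_def)
    then have "card (insert 1 (insert 2 (insert (-3) S'))) = n"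
      using S' n by simp
    moreover have "\<Sum>(insert 1 (insert 2 (insert (-3) S'))) = 0"
      using S' S'' by simp
    ultimately show ?thesis using S'' 3 assms
      by (intro exI[of _ "insert 1 (insert 2 (insert (-3) S'))"]) auto
  qed
qed

section \<open>Blocks as complements of points\<close>

text \<open>Labels each block by the point it misses. The sets \<open>M x\<close> of blocks missing
  \<open>x\<close> are disjoint, and any two of them have two elements in total, so with three
  points available each has exactly one.\<close>

lemma block_design_complements:
  fixes B :: "nat \<Rightarrow> 'n::finite set"
  assumes "block_design (CARD('n)) (CARD('n) - 1) (CARD('n) - 2) b B"
    and b: "b = CARD('n)" and n: "CARD('n) \<ge> 3"
  shows "\<exists>c. bij_betw c UNIV {1..b} \<and> (\<forall>x. x \<notin> B (c x))"
proof -
  define M where "M x = {i\<in>{1..b}. x \<notin> B i}" for x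
  have fin: "finite (M x)" for x by (simp add: M_def)
  have B: "card (B i) = CARD('n) - 1" if "i \<in> {1..b}" for i
    using assms(1) that by (simp add: block_design_def)
  have disj: "M x \<inter> M y = {}" if "x \<noteq> y" for x y
  proof (rule ccontr)
    assume "M x \<inter> M y \<noteq> {}"
    then obtain i where i: "i \<in> {1..b}" "x \<notin> B i" "y \<notin> B i" by (auto simp: M_def)
    then have "B i \<subseteq> UNIV - {x, y}" by auto
    then have "card (B i) \<le> card (UNIV - {x, y})" by (intro card_mono) auto
    also have "\<dots> = CARD('n) - 2" using that by (simp add: card_Diff_subset)
    finally show False using B[OF i(1)] n by simp
  qed
  have two: "card (M x) + card (M y) = 2" if "x \<noteq> y" for x y
  proof -
    have un: "card (M x \<union> M y) = card (M x) + card (M y)"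
      using disj[OF that] fin by (simp add: card_Un_disjoint)
    have "{i\<in>{1..b}. x \<in> B i \<and> y \<in> B i} = {1..b} - (M x \<union> M y)"
      by (auto simp: M_def)
    moreover have "card {i\<in>{1..b}. x \<in> B i \<and> y \<in> B i} = CARD('n) - 2"
      using assms(1) that by (simp add: block_design_def)
    moreover have sub: "M x \<union> M y \<subseteq> {1..b}" by (auto simp: M_def)
    ultimately have "b - card (M x \<union> M y) = CARD('n) - 2"
      using fin by (metis card_Diff_subset card_atLeastAtMost diff_Suc_1 finite_UnI)
    moreover have "card (M x \<union> M y) \<le> b" using card_mono[OF _ sub] by simp
    ultimately show ?thesis using un b n by linarith
  qed
  \<comment> \<open>The three pairwise sums over distinct \<open>x\<close>, \<open>y\<close>,
    \<open>z\<close> all equal 2, which makes the three cardinalities equal.\<close>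
  have one: "card (M x) = 1" for x
  proof -
    have "\<exists>y. y \<notin> {x}" using n card_mono[of "{x}" "UNIV :: 'n set"] by fastforce
    then obtain y where y: "y \<noteq> x" by auto
    have "\<exists>z. z \<notin> {x, y}"
    proof (rule ccontr)
      assume "\<not> ?thesis"
      then have "CARD('n) \<le> card {x, y}" by (intro card_mono) auto
      also have "\<dots> \<le> 2" using y by simp
      finally show False using n by simp
    qed
    then obtain z where "z \<noteq> x" "z \<noteq> y" by auto
    then show ?thesis using two[of x y] two[of x z] two[of y z] y by auto
  qed
  have "\<exists>i. i \<in> M x" for x using one[of x] by (metis all_not_in_conv card.empty zero_neq_one)
  then obtain c where c: "\<And>x. c x \<in> M x" by metis
  have inj: "inj c" using c disj by (metis disjoint_iff injI)
  have "range c \<subseteq> {1..b}" using c by (auto simp: M_def)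
  then have "range c = {1..b}"
    using inj b by (intro card_subset_eq) (simp_all add: card_image)
  then have "bij_betw c UNIV {1..b}" using inj by (simp add: bij_betw_def)
  then show ?thesis using c by (auto simp: M_def)
qed

section \<open>Hyperplane sections of the curve and vitality\<close>

lemma zero_sum_if_orthogonal_gap_curve:
  fixes g :: "'n::finite \<Rightarrow> nat" and a :: "real ^ 'n"
  assumes g: "inj g" "range g = {..n} - {n - 1}" and "n \<ge> 1"
    and S: "finite S" "inj_on t S" "card S \<ge> n"
    and a: "a \<noteq> 0" "\<And>i. i \<in> S \<Longrightarrow> gap_curve g (t i) \<bullet> a = 0"
  shows "card S = n \<and> (\<Sum>i\<in>S. t i) = 0"
proof (rule zero_sum_if_poly_vanishes[OF S \<open>n \<ge> 1\<close>])
  obtain k where "a $ k \<noteq> 0" using a(1) by (auto simp: vec_eq_iff)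
  then show "gap_poly g a \<noteq> 0" using coeff_gap_poly[OF g(1), of a k] by auto
  show "degree (gap_poly g a) \<le> n"
  proof (rule degree_le, intro allI impI coeff_gap_poly_eq_0)
    show "m \<notin> range g" if "n < m" for m using that by (simp add: g(2))
  qed
  show "coeff (gap_poly g a) (n - 1) = 0" by (rule coeff_gap_poly_eq_0) (simp add: g(2))
  show "poly (gap_poly g a) (t i) = 0" if "i \<in> S" for i
    using a(2)[OF that] by (simp add: inner_gap_curve)
qed

text \<open>The normal vector consists of the coefficients of the monic polynomial with roots
  \<open>t i\<close>; the zero sum kills exactly its coefficient at the gap.\<close>

lemma ex_orthogonal_gap_curve_if_zero_sum:
  fixes g :: "'n::finite \<Rightarrow> nat"
  assumes g: "inj g" "range g = {..n} - {n - 1}" and n: "n \<ge> 1"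
    and S: "finite S" "card S = n" "(\<Sum>i\<in>S. t i) = 0"
  shows "\<exists>a :: real ^ 'n. a \<noteq> 0 \<and> (\<forall>i\<in>S. gap_curve g (t i) \<bullet> a = 0)"
proof -
  define p where "p = (\<Prod>i\<in>S. [:- t i, 1:])"
  have lead: "coeff p n = 1" using lead_coeff_prod_linear[OF S(1), of t] S(2) by (simp add: p_def)
  have deg: "degree p = n" using degree_prod_linear[OF S(1), of t] S(2) by (simp add: p_def)
  have "coeff p (n - 1) = - (\<Sum>i\<in>S. t i)"
    unfolding p_def by (rule subleading_coeff_prod_linear) (use S n in auto)
  then have zero: "coeff p m = 0" if "m \<notin> range g" for m
    using that S(3) deg by (cases "m = n - 1") (auto simp: g(2) coeff_eq_0)
  define a where "a = (\<chi> k. coeff p (g k))"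
  have pa: "gap_poly g a = p" unfolding a_def by (rule gap_poly_coeffs[OF g(1) zero])
  have "gap_poly g 0 = 0" by (simp add: gap_poly_def)
  then have "a \<noteq> 0" using pa lead by auto
  moreover have "gap_curve g (t i) \<bullet> a = 0" if "i \<in> S" for i
    using that S(1) by (auto simp: inner_gap_curve pa p_def poly_prod)
  ultimately show ?thesis by blast
qed

lemma vital_frame_gap_curve:
  fixes g :: "'n::finite \<Rightarrow> nat"
  assumes g: "inj g" "range g = {..n} - {n - 1}" and n: "n = CARD('n)"
    and I: "finite I" "card I = 2 * n" "inj_on t I" "(\<Sum>i\<in>I. t i) \<noteq> 0"
    and avoid: "\<And>j. j \<in> I \<Longrightarrow> \<exists>S. S \<subseteq> I - {j} \<and> card S = n \<and> (\<Sum>i\<in>S. t i) = 0"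
  shows "vital_frame I (\<lambda>i. gap_curve g (t i))"
proof -
  let ?u = "\<lambda>i. gap_curve g (t i)"
  have n1: "n \<ge> 1" using n by (simp add: Suc_leI)
  have pr: "permits_phase_retrieval I ?u"
    unfolding permits_phase_retrieval_iff
  proof (intro allI impI, rule ccontr)
    fix a b assume ab: "\<forall>i\<in>I. ?u i \<bullet> a = 0 \<or> ?u i \<bullet> b = 0" and "\<not> (a = 0 \<or> b = 0)"
    then have nz: "a \<noteq> 0" "b \<noteq> 0" by auto
    define S where "S c = {i\<in>I. ?u i \<bullet> c = 0}" for c
    have fin: "finite (S c)" for c using I(1) by (simp add: S_def)
    have zero: "card (S c) = n \<and> (\<Sum>i\<in>S c. t i) = 0" if "c \<noteq> 0" "card (S c) \<ge> n" for c
      using that I(3) by (intro zero_sum_if_orthogonal_gap_curve[OF g n1 fin])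
        (auto simp: S_def intro: inj_on_subset)
    have cover: "S a \<union> S b = I" using ab by (auto simp: S_def)
    \<comment> \<open>Inclusion-exclusion: two sets of size at most \<open>n\<close> that cover
      \<open>2 * n\<close> indices have size \<open>n\<close> each and are disjoint, so the total
      would be a sum of two zeros.\<close>
    have sum_card: "2 * n + card (S a \<inter> S b) = card (S a) + card (S b)"
      using card_Un_Int[OF fin fin, of a b] cover I(2) by simp
    have "card (S a) \<le> n" "card (S b) \<le> n"
      using zero[OF nz(1)] zero[OF nz(2)] by linarith+
    then have cards: "card (S a) = n" "card (S b) = n" "card (S a \<inter> S b) = 0"
      using sum_card by linarith+
    then have "S a \<inter> S b = {}" using fin by simp
    then have "(\<Sum>i\<in>I. t i) = (\<Sum>i\<in>S a. t i) + (\<Sum>i\<in>S b. t i)"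
      using cover fin by (metis sum.union_disjoint)
    then show False using zero[OF nz(1)] zero[OF nz(2)] cards I(4) by simp
  qed
  have "\<not> permits_phase_retrieval (I - {j}) ?u" if j: "j \<in> I" for j
  proof -
    obtain S where S: "S \<subseteq> I - {j}" "card S = n" "(\<Sum>i\<in>S. t i) = 0"
      using avoid[OF j] by blast
    have fin: "finite S" using S(1) I(1) finite_subset by blast
    obtain a :: "real ^ 'n" where a: "a \<noteq> 0" "\<forall>i\<in>S. ?u i \<bullet> a = 0"
      using ex_orthogonal_gap_curve_if_zero_sum[OF g n1 fin S(2,3)] by blast
    \<comment> \<open>Without \<open>j\<close>, the vectors over \<open>S\<close> lie in one
      hyperplane, and the \<open>n - 1\<close> others are too few to span, so they lie in
      another.\<close>
    have "card (I - {j} - S) = 2 * n - 1 - n"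
      using S fin j I(1,2) by (simp add: card_Diff_subset)
    then have "card (I - {j} - S) < CARD('n)" using n n1 by simp
    then obtain b :: "real ^ 'n" where b: "b \<noteq> 0" "\<forall>i\<in>I - {j} - S. ?u i \<bullet> b = 0"
      using ex_orthogonal_if_card_less[of "I - {j} - S" ?u] I(1) by auto
    have "\<forall>i\<in>I - {j}. ?u i \<bullet> a = 0 \<or> ?u i \<bullet> b = 0" using a b by blast
    then show ?thesis unfolding permits_phase_retrieval_iff using a(1) b(1) by blast
  qed
  then show ?thesis
    using pr vector_frame_if_permits_phase_retrieval[OF I(1) pr] by (simp add: vital_frame_def)
qed

section \<open>Consequences of equivalence to a design frame\<close>

text \<open>\<open>p j\<close> is the index of the vector that \<open>A\<close> sends to the basis
  vector at \<open>j\<close>, and \<open>q k\<close> that of the vector attached to the block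
  missing \<open>k\<close>. The images of \<open>q k\<close> and of all \<open>p j\<close> with
  \<open>j \<noteq> k\<close> have \<open>k\<close>-th coordinate 0, so row \<open>k\<close> of
  \<open>A\<close> is a common normal.\<close>

lemma matching_if_equivalent_to_design_frame:
  fixes u w :: "nat \<Rightarrow> real ^ 'n"
  assumes design: "block_design (CARD('n)) (CARD('n) - 1) (CARD('n) - 2) b (B :: nat \<Rightarrow> 'n set)"
    and w: "comes_from_design {1..m} w b B" and equiv: "equivalent_frames m u w"
    and m: "m = 2 * CARD('n)" and n: "CARD('n) \<ge> 3"
  obtains p q :: "'n \<Rightarrow> nat" where
    "inj p" "inj q" "range p \<inter> range q = {}" "range p \<union> range q = {1..m}"
    "\<And>k. \<exists>a. a \<noteq> 0 \<and> u (q k) \<bullet> a = 0 \<and> (\<forall>j. j \<noteq> k \<longrightarrow> u (p j) \<bullet> a = 0)"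
proof -
  obtain v h where h: "bij_betw h ((UNIV :: 'n set) <+> {1..b}) {1..m}"
    and e: "\<And>j. w (h (Inl j)) = axis j 1"
    and v: "\<And>i. i \<in> {1..b} \<Longrightarrow> w (h (Inr i)) = v i \<and> {j. v i $ j \<noteq> 0} \<subseteq> B i"
    using w unfolding comes_from_design_def by blast
  obtain A :: "real ^ 'n ^ 'n" and \<sigma> where A: "invertible A" and \<sigma>: "\<sigma> permutes {1..m}"
    and Au: "\<And>i. i \<in> {1..m} \<Longrightarrow> A *v u i = w (\<sigma> i)"
    using equiv unfolding equivalent_frames_def by blast
  \<comment> \<open>The number of blocks is read off from the size of the frame.\<close>
  have "CARD('n) + b = m" using bij_betw_same_card[OF h] by (simp add: card_Plus)
  then have b: "b = CARD('n)" using m by simp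
  obtain c where c: "bij_betw c UNIV {1..b}" "\<And>x. x \<notin> B (c x)"
    using block_design_complements[OF design b n] by blast
  \<comment> \<open>Pulls the labelling of \<open>w\<close> by points and blocks back to the indices
    of \<open>u\<close>.\<close>
  define r where "r = inv \<sigma> \<circ> h"
  have r: "bij_betw r ((UNIV :: 'n set) <+> {1..b}) {1..m}"
    unfolding r_def using h permutes_imp_bij[OF permutes_inv[OF \<sigma>]] by (rule bij_betw_trans)
  have Ar: "A *v u (r x) = w (h x)" if "x \<in> (UNIV :: 'n set) <+> {1..b}" for x
    using Au[of "r x"] bij_betwE[OF r] that permutes_inverses(1)[OF \<sigma>] by (auto simp: r_def)
  define p where "p = (\<lambda>k. r (Inl k))"
  define q where "q = (\<lambda>k. r (Inr (c k)))"
  have cb: "c k \<in> {1..b}" for k using bij_betwE[OF c(1)] by blast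
  have rinj: "inj_on r ((UNIV :: 'n set) <+> {1..b})" using r by (rule bij_betw_imp_inj_on)
  have cinj: "inj c" using c(1) by (rule bij_betw_imp_inj_on)
  show thesis
  proof
    show "inj p" unfolding p_def by (rule injI) (auto dest: inj_onD[OF rinj])
    show "inj q" unfolding q_def
      by (rule injI) (use cb in \<open>auto dest!: inj_onD[OF rinj] dest: injD[OF cinj]\<close>)
    show "range p \<inter> range q = {}" unfolding p_def q_def
      using cb by (auto dest!: inj_onD[OF rinj])
    have "range p \<union> range q = r ` (range Inl \<union> Inr ` range c)"
      by (auto simp: p_def q_def)
    also have "range Inl \<union> Inr ` range c = (UNIV :: 'n set) <+> {1..b}"
      using bij_betw_imp_surj_on[OF c(1)] by (simp add: Plus_def)
    finally show "range p \<union> range q = {1..m}" using bij_betw_imp_surj_on[OF r] by simp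
    fix k
    have comp: "u i \<bullet> row k A = (A *v u i) $ k" for i
      by (simp add: matrix_vector_mul_component inner_commute row_def)
    have "row k A \<noteq> 0"
    proof
      assume "row k A = 0"
      then have "det A = 0" by (rule det_zero_row(2))
      then show False using A invertible_det_nz by blast
    qed
    moreover have "u (q k) \<bullet> row k A = 0"
    proof -
      have "A *v u (q k) = v (c k)" using Ar[OF InrI[OF cb]] v[OF cb] by (metis q_def)
      then show ?thesis using v[OF cb[of k]] c(2)[of k] by (auto simp: comp)
    qed
    moreover have "u (p j) \<bullet> row k A = 0" if "j \<noteq> k" for j
    proof -
      have "A *v u (p j) = axis j 1" using Ar[OF InlI[OF UNIV_I]] e by (metis p_def)
      then show ?thesis using that by (simp add: comp axis_def)
    qed
    ultimately show "\<exists>a. a \<noteq> 0 \<and> u (q k) \<bullet> a = 0 \<and> (\<forall>j. j \<noteq> k \<longrightarrow> u (p j) \<bullet> a = 0)"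
      by blast
  qed
qed

section \<open>The explicit frame and the contradiction\<close>

theorem proposition5p7:
  assumes "CARD('n::finite) > 3"
  shows "\<exists>\<F> :: (nat \<Rightarrow> real ^ 'n) set.
           \<F> \<noteq> {} \<and>
           (\<forall>u\<in>\<F>. vital_frame {1..2 * CARD('n)} u \<and>
              \<not> (\<exists>w b B.
                   block_design (CARD('n)) (CARD('n) - 1) (CARD('n) - 2) b (B :: nat \<Rightarrow> 'n set) \<and>
                   comes_from_design {1..2 * CARD('n)} w b B \<and>
                   equivalent_frames (2 * CARD('n)) u w))"
proof -
  define n where "n = CARD('n)"
  have n: "n > 3" using assms by (simp add: n_def)
  have n3: "3 \<le> CARD('n)" using assms by simp
  let ?I = "{1..2 * n}"
  obtain e :: "'n \<Rightarrow> nat" where e: "bij_betw e UNIV {..<n}"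
    using ex_bij_betw_finite_nat[of "UNIV :: 'n set"] by (auto simp: n_def atLeast0LessThan)
  define g where "g = (\<lambda>k. if k = n - 1 then n else k) \<circ> e"
  have "bij_betw g UNIV ({..n} - {n - 1})"
    unfolding g_def using e bij_exponents n by (intro bij_betw_trans) auto
  then have g: "inj g" "range g = {..n} - {n - 1}" by (auto simp: bij_betw_def)
  \<comment> \<open>Indices 1 to \<open>2 * n - 1\<close> carry the integers from
    \<open>1 - n\<close> to \<open>n - 1\<close>, so index \<open>n\<close> carries 0; the last
    index carries the extra parameter.\<close>
  define t :: "nat \<Rightarrow> real" where "t i = (if i = 2 * n then 1 / 2 else real i - real n)" for i
  have half: "real i - real n \<noteq> 1 / 2" for i
  proof
    assume "real i - real n = 1 / 2"
    then have "real (2 * i) = real (2 * n + 1)" by simp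
    then have "2 * i = 2 * n + 1" by (simp only: of_nat_eq_iff)
    then show False by presburger
  qed
  have inj: "inj_on t ?I"
  proof (rule inj_onI)
    fix i j assume "t i = t j"
    then show "i = j"
      using half[of i] half[of j] by (cases "i = 2 * n"; cases "j = 2 * n") (auto simp: t_def)
  qed
  have total: "(\<Sum>i\<in>?I. t i) = 1 / 2"
  proof -
    have "(\<Sum>i\<in>{1..2 * n}. t i) = t (2 * n) + (\<Sum>i\<in>{1..2 * n - 1}. t i)"
      using n by (cases "2 * n") auto
    \<comment> \<open>Reflecting the indices negates the integer parameters, so their sum equals its
      own negative.\<close>
    also have "(\<Sum>i\<in>{1..2 * n - 1}. t i) = (\<Sum>i\<in>{1..2 * n - 1}. t (2 * n - i))"
      by (rule sum.reindex_bij_witness[of _ "\<lambda>i. 2 * n - i" "\<lambda>i. 2 * n - i"]) auto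
    also have "\<dots> = (\<Sum>i\<in>{1..2 * n - 1}. - t i)"
      by (rule sum.cong) (auto simp: t_def of_nat_diff)
    finally have "(\<Sum>i\<in>{1..2 * n}. t i) = t (2 * n) + (\<Sum>i\<in>{1..2 * n - 1}. - t i)" .
    moreover have "(\<Sum>i\<in>{1..2 * n - 1}. t i) = (\<Sum>i\<in>{1..2 * n - 1}. - t i)"
      using calculation \<open>sum t {1..2 * n} = t (2 * n) + sum t {1..2 * n - 1}\<close> by simp
    ultimately show ?thesis by (simp add: sum_negf t_def)
  qed
  have avoid: "\<exists>S. S \<subseteq> ?I - {j} \<and> card S = n \<and> (\<Sum>i\<in>S. t i) = 0" for j
  proof -
    \<comment> \<open>\<open>Z\<close> holds integer parameters only. For \<open>j = 2 * n\<close>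
      the excluded value is \<open>n\<close>, outside the interval, and index \<open>2 * n\<close>
      is avoided anyway.\<close>
    obtain Z where Z: "Z \<subseteq> {1 - int n..int n - 1} - {int j - int n}" "card Z = n" "\<Sum>Z = 0"
      using zero_sum_subset_avoiding[of n "int j - int n"] n by auto
    let ?f = "\<lambda>z. nat (z + int n)"
    have injf: "inj_on ?f Z" using Z(1) by (intro inj_onI) (auto simp: subset_iff)
    have "?f ` Z \<subseteq> ?I - {j}"
    proof
      fix i assume "i \<in> ?f ` Z"
      then obtain z where "z \<in> Z" "i = nat (z + int n)" by blast
      moreover from this have "1 - int n \<le> z \<and> z \<le> int n - 1 \<and> z \<noteq> int j - int n"
        using Z(1) by auto
      ultimately show "i \<in> ?I - {j}" by auto
    qed
    moreover have "(\<Sum>i\<in>?f ` Z. t i) = (\<Sum>z\<in>Z. real_of_int z)"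
      unfolding sum.reindex[OF injf] using Z(1) by (intro sum.cong) (auto simp: t_def subset_iff)
    moreover have "\<dots> = 0" using Z(3) by (simp flip: of_int_sum)
    ultimately show ?thesis
      using Z(2) by (intro exI[of _ "?f ` Z"]) (simp add: card_image[OF injf])
  qed
  let ?u = "\<lambda>i. gap_curve g (t i)"
  have "vital_frame ?I ?u"
    using inj total avoid by (intro vital_frame_gap_curve[OF g n_def]) auto
  moreover have False
    if D: "block_design (CARD('n)) (CARD('n) - 1) (CARD('n) - 2) b (B :: nat \<Rightarrow> 'n set)"
      "comes_from_design ?I w b B" "equivalent_frames (2 * n) ?u w" for w b B
  proof -
    obtain p q :: "'n \<Rightarrow> nat" where p: "inj p" and q: "inj q"
      and disj: "range p \<inter> range q = {}" and cover: "range p \<union> range q = ?I"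
      and orth: "\<And>k. \<exists>a. a \<noteq> 0 \<and> ?u (q k) \<bullet> a = 0 \<and> (\<forall>j. j \<noteq> k \<longrightarrow> ?u (p j) \<bullet> a = 0)"
      by (rule matching_if_equivalent_to_design_frame[OF D[unfolded n_def] refl n3, folded n_def])
         (rule that)
    define s where "s = (\<Sum>k\<in>UNIV. t (p k))"
    have pair: "t (p k) - t (q k) = s" for k
    proof -
      obtain a where a: "a \<noteq> 0" "?u (q k) \<bullet> a = 0" "\<And>j. j \<noteq> k \<Longrightarrow> ?u (p j) \<bullet> a = 0"
        using orth by blast
      \<comment> \<open>These \<open>n\<close> indices lie in one hyperplane, so their parameters,
        which add up to \<open>s - t (p k) + t (q k)\<close>, sum to zero.\<close>
      let ?S = "insert (q k) (p ` (UNIV - {k}))"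
      have qk: "q k \<notin> p ` (UNIV - {k})" using disj by auto
      have pk: "inj_on p (UNIV - {k})" using p by (rule inj_on_subset) auto
      have "card ?S = n" using qk n by (simp add: card_image[OF pk] card_Diff_singleton n_def)
      moreover have "inj_on t ?S" using inj by (rule inj_on_subset) (use cover in auto)
      ultimately have "(\<Sum>i\<in>?S. t i) = 0"
        using zero_sum_if_orthogonal_gap_curve[OF g, of ?S t a] a n by auto
      moreover have "(\<Sum>i\<in>?S. t i) = t (q k) + (\<Sum>j\<in>UNIV - {k}. t (p j))"
        using qk by (simp add: sum.reindex[OF pk])
      moreover have "s = t (p k) + (\<Sum>j\<in>UNIV - {k}. t (p j))"
        unfolding s_def by (rule sum.remove) auto
      ultimately show ?thesis by simp
    qed
    have "(\<Sum>k\<in>UNIV. t (p k) - t (q k)) = real n * s"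
      unfolding pair by (simp add: n_def)
    then have 1: "s - (\<Sum>k\<in>UNIV. t (q k)) = real n * s"
      by (simp add: s_def sum_subtractf)
    have "(\<Sum>i\<in>range p \<union> range q. t i) = s + (\<Sum>k\<in>UNIV. t (q k))"
      using disj by (simp add: sum.union_disjoint s_def sum.reindex p q)
    then have 2: "s + (\<Sum>k\<in>UNIV. t (q k)) = 1 / 2" using total cover by simp
    have s: "2 * ((2 - real n) * s) = 1" using 1 2 by (simp add: algebra_simps)
    \<comment> \<open>The parameter 0 sits at index \<open>n\<close>. By \<open>pair\<close> its
      partner has parameter \<open>s\<close> or \<open>-s\<close>, so the absolute value of
      \<open>s\<close> is attained by a parameter.\<close>
    have "n \<in> range p \<union> range q" using cover n by auto
    then obtain i where i: "i \<in> ?I" "\<bar>t i\<bar> = \<bar>s\<bar>"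
    proof -
      have "t n = 0" using n by (simp add: t_def)
      moreover obtain k where "n = p k \<or> n = q k" using \<open>n \<in> range p \<union> range q\<close> by auto
      ultimately have "\<bar>t (q k)\<bar> = \<bar>s\<bar> \<or> \<bar>t (p k)\<bar> = \<bar>s\<bar>" using pair[of k] by auto
      moreover have "q k \<in> ?I" "p k \<in> ?I" using cover by auto
      ultimately show thesis using that by blast
    qed
    have "\<bar>s\<bar> * (real n - 2) = 1 / 2"
    proof -
      have "\<bar>(2 - real n) * s\<bar> = 1 / 2" using s by simp
      then show ?thesis using n by (simp add: abs_mult mult.commute)
    qed
    moreover have "s = 0 \<or> \<bar>s\<bar> \<ge> 1 / 2"
    proof -
      have "t i = 0 \<or> \<bar>t i\<bar> \<ge> 1 / 2"
        by (cases "i \<ge> n"; cases "i = n") (auto simp: t_def)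
      then show ?thesis using i(2) by auto
    qed
    \<comment> \<open>Here \<open>n > 3\<close> enters: the factor \<open>real n - 2\<close> is at
      least 2, so the product is at least 1 instead of 1/2.\<close>
    moreover have "\<bar>s\<bar> * (real n - 2) \<ge> 1 / 2 * 2" if "\<bar>s\<bar> \<ge> 1 / 2"
      using that n by (intro mult_mono) auto
    ultimately show False by (cases "s = 0") auto
  qed
  \<comment> \<open>A singleton already serves as the nonempty set of frames.\<close>
  ultimately show ?thesis
    unfolding n_def by (intro exI[of _ "{?u}"] conjI ballI) (simp, simp, blast)
qed

end
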